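(* Let $(\mathfrak{k},J',\langle\cdot,\cdot\rangle')$ be a Kähler flat Lie algebra with fundamental $2$-form $\omega'$ and let $D'$ be a skew-symmetric derivation of $\mathfrak{k}$ such that $J'D'=D'J'$. Let $D$ be the skew-symmetric derivation of the central extension $\mathfrak{k}_{\omega'}(B)$ defined by $D(B)=0$, $D|_{\mathfrak{k}}=D'$. Then the double extension $\mathfrak{g}:=\mathfrak{k}(D,\omega')=\mathbb{R}A\ltimes_D\mathfrak{k}_{\omega'}(B)$ admits a Vaisman structure $(J,\langle\cdot,\cdot\rangle)$, where $JA=B$, $J|_{\mathfrak{k}}=J'$, and $\langle\cdot,\cdot\rangle$ extends $\langle\cdot,\cdot\rangle'$ by $|A|=|B|=1$, $\langle A,B\rangle=0$, $\langle A,\mathfrak{k}\rangle=\langle B,\mathfrak{k}\rangle=0$. The Lie algebra $\mathfrak{g}$ is unimodular and solvable, and the Lee form $\theta$ is the metric dual of $A$, i.e. $\theta(x)=\langle A,x\rangle$ for $x\in\mathfrak{g}$.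
   Context: All Lie algebras are real and finite-dimensional. A Lie algebra is unimodular if $\operatorname{tr}(\operatorname{ad}_x)=0$ for all $x$. $d$ denotes the Chevalley–Eilenberg differential (so $d\alpha(x,y)=-\alpha([x,y])$ for a $1$-form $\alpha$). A complex structure on $\mathfrak{g}$ is an endomorphism $J$ with $J^2=-\mathrm{Id}$ and $[Jx,Jy]-[x,y]-J([Jx,y]+[x,Jy])=0$ for all $x,y$. Given a Hermitian inner product $\langle\cdot,\cdot\rangle$ (i.e. $\langle Jx,Jy\rangle=\langle x,y\rangle$), the fundamental $2$-form is $\omega(x,y)=\langle Jx,y\rangle$. $(J,\langle\cdot,\cdot\rangle)$ (complex structure plus Hermitian inner product) is an LCK structure on $\mathfrak{g}$ if there is $\theta\in\mathfrak{g}^*$ (the Lee form) with $d\theta=0$ and $d\omega=\theta\wedge\omega$; it is Vaisman if moreover $\nabla\theta=0$, where $\nabla$ is the Levi-Civita connection, given by $\langle\nabla_xy,z\rangle=\frac12(\langle[x,y],z\rangle-\langle[y,z],x\rangle+\langle[z,x],y\rangle)$. A Kähler structure is a Hermitian structure (with $J$ a complex structure) such that $d\omega=0$. A Kähler flat Lie algebra is a Lie algebra with a Kähler structure whose inner product is flat (the Levi-Civita connection has zero curvature). Central extension: for a Lie algebra $\mathfrak{h}$ and a closed $2$-form $\beta$ on $\mathfrak{h}$, $\mathfrak{h}_\beta(\xi)$ denotes the vector space $\mathbb{R}\xi\oplus\mathfrak{h}$ with bracket $[x,y]_\beta=\beta(x,y)\xi+[x,y]_{\mathfrak{h}}$, $[\xi,x]_\beta=0$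 for $x,y\in\mathfrak{h}$. Double extension: for a derivation $D$ of $\mathfrak{h}_\beta(\xi)$, $\mathfrak{h}(D,\beta):=\mathbb{R}\ltimes_D\mathfrak{h}_\beta(\xi)$, the semidirect product in which a generator $A$ of $\mathbb{R}$ acts by $[A,x]=Dx$. On $\mathfrak{k}_{\omega'}(B)$, skew-symmetry of $D$ refers to the inner product extending $\langle\cdot,\cdot\rangle'$ with $B$ a unit vector orthogonal to $\mathfrak{k}$. *)

theory Defs
  imports "HOL-Analysis.Analysis"
begin

text \<open>
  Lie algebras live on a whole type of class \<^class>\<open>real_vector\<close> and are given by their bracket;
  inner products are explicit bilinear forms, so that no inner product is singled out by the type
  and the zero space is not excluded.
\<close>

definition lie_algebra :: "('a::real_vector \<Rightarrow> 'a \<Rightarrow> 'a) \<Rightarrow> bool" where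
  "lie_algebra br \<longleftrightarrow>
     (\<exists>B. finite B \<and> span B = (UNIV :: 'a set)) \<and>
     bilinear br \<and>
     (\<forall>x. br x x = 0) \<and>
     (\<forall>x y z. br x (br y z) + br y (br z x) + br z (br x y) = 0)"

definition lie_derivation :: "('a::real_vector \<Rightarrow> 'a \<Rightarrow> 'a) \<Rightarrow> ('a \<Rightarrow> 'a) \<Rightarrow> bool" where
  "lie_derivation br D \<longleftrightarrow> linear D \<and> (\<forall>x y. D (br x y) = br (D x) y + br x (D y))"

text \<open>The value does not depend on the basis chosen, see \<open>lin_trace_eq\<close> below.\<close>

definition lin_trace :: "('a::real_vector \<Rightarrow> 'a) \<Rightarrow> real" where
  "lin_trace f = (\<Sum>b\<in>real_vector.extend_basis {}.
     real_vector.representation (real_vector.extend_basis {}) (f b) b)"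

definition unimodular :: "('a::real_vector \<Rightarrow> 'a \<Rightarrow> 'a) \<Rightarrow> bool" where
  "unimodular br \<longleftrightarrow> (\<forall>x. lin_trace (br x) = 0)"

primrec derived_series :: "('a::real_vector \<Rightarrow> 'a \<Rightarrow> 'a) \<Rightarrow> nat \<Rightarrow> 'a set" where
  "derived_series br 0 = UNIV"
| "derived_series br (Suc n) =
     span {br x y | x y. x \<in> derived_series br n \<and> y \<in> derived_series br n}"

definition solvable :: "('a::real_vector \<Rightarrow> 'a \<Rightarrow> 'a) \<Rightarrow> bool" where
  "solvable br \<longleftrightarrow> (\<exists>n. derived_series br n = {0})"

text \<open>The Chevalley--Eilenberg differential on 1-forms and 2-forms.\<close>

definition d1 :: "('a \<Rightarrow> 'a \<Rightarrow> 'a) \<Rightarrow> ('a \<Rightarrow> real) \<Rightarrow> 'a \<Rightarrow> 'a \<Rightarrow> real" where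
  "d1 br \<alpha> x y = - \<alpha> (br x y)"

definition d2 :: "('a \<Rightarrow> 'a \<Rightarrow> 'a) \<Rightarrow> ('a \<Rightarrow> 'a \<Rightarrow> real) \<Rightarrow> 'a \<Rightarrow> 'a \<Rightarrow> 'a \<Rightarrow> real" where
  "d2 br \<beta> x y z = - \<beta> (br x y) z + \<beta> (br x z) y - \<beta> (br y z) x"

text \<open>
  The wedge product of a 1-form and a 2-form, normalised so that
  \<open>(\<alpha> \<and> \<beta>) x y = \<alpha> x * \<beta> y - \<alpha> y * \<beta> x\<close> for 1-forms; this is the convention under which
  \<open>d1\<close>, \<open>d2\<close> satisfy the Leibniz rule.
\<close>

definition wedge12 :: "('a \<Rightarrow> real) \<Rightarrow> ('a \<Rightarrow> 'a \<Rightarrow> real) \<Rightarrow> 'a \<Rightarrow> 'a \<Rightarrow> 'a \<Rightarrow> real" where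
  "wedge12 \<theta> \<beta> x y z = \<theta> x * \<beta> y z - \<theta> y * \<beta> x z + \<theta> z * \<beta> x y"

definition inner_product :: "('a::real_vector \<Rightarrow> 'a \<Rightarrow> real) \<Rightarrow> bool" where
  "inner_product g \<longleftrightarrow>
     bilinear g \<and> (\<forall>x y. g x y = g y x) \<and> (\<forall>x. x \<noteq> 0 \<longrightarrow> g x x > 0)"

definition skew_symmetric :: "('a \<Rightarrow> 'a \<Rightarrow> real) \<Rightarrow> ('a \<Rightarrow> 'a) \<Rightarrow> bool" where
  "skew_symmetric g D \<longleftrightarrow> (\<forall>x y. g (D x) y = - g x (D y))"

text \<open>
  The Levi-Civita connection through the Koszul formula for left-invariant fields; the vector is
  uniquely determined, see \<open>levi_civita\<close> below.
\<close>

definition nabla :: "('a::real_vector \<Rightarrow> 'a \<Rightarrow> 'a) \<Rightarrow> ('a \<Rightarrow> 'a \<Rightarrow> real) \<Rightarrow> 'a \<Rightarrow> 'a \<Rightarrow> 'a" where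
  "nabla br g x y =
     (THE v. \<forall>z. g v z = 1/2 * (g (br x y) z - g (br y z) x + g (br z x) y))"

definition curvature ::
    "('a::real_vector \<Rightarrow> 'a \<Rightarrow> 'a) \<Rightarrow> ('a \<Rightarrow> 'a \<Rightarrow> real) \<Rightarrow> 'a \<Rightarrow> 'a \<Rightarrow> 'a \<Rightarrow> 'a" where
  "curvature br g x y z =
     nabla br g x (nabla br g y z) - nabla br g y (nabla br g x z) - nabla br g (br x y) z"

definition flat :: "('a::real_vector \<Rightarrow> 'a \<Rightarrow> 'a) \<Rightarrow> ('a \<Rightarrow> 'a \<Rightarrow> real) \<Rightarrow> bool" where
  "flat br g \<longleftrightarrow> (\<forall>x y z. curvature br g x y z = 0)"

text \<open>
  The covariant derivative \<open>(\<nabla>\<^sub>x \<theta>) y\<close> of a left-invariant 1-form; the term differentiating the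
  constant function \<open>\<theta> y\<close> vanishes.
\<close>

definition nabla_form ::
    "('a::real_vector \<Rightarrow> 'a \<Rightarrow> 'a) \<Rightarrow> ('a \<Rightarrow> 'a \<Rightarrow> real) \<Rightarrow> ('a \<Rightarrow> real) \<Rightarrow> 'a \<Rightarrow> 'a \<Rightarrow> real" where
  "nabla_form br g \<theta> x y = - \<theta> (nabla br g x y)"

definition parallel_form ::
    "('a::real_vector \<Rightarrow> 'a \<Rightarrow> 'a) \<Rightarrow> ('a \<Rightarrow> 'a \<Rightarrow> real) \<Rightarrow> ('a \<Rightarrow> real) \<Rightarrow> bool" where
  "parallel_form br g \<theta> \<longleftrightarrow> (\<forall>x y. nabla_form br g \<theta> x y = 0)"

definition complex_structure :: "('a::real_vector \<Rightarrow> 'a \<Rightarrow> 'a) \<Rightarrow> ('a \<Rightarrow> 'a) \<Rightarrow> bool" where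
  "complex_structure br J \<longleftrightarrow>
     linear J \<and> (\<forall>x. J (J x) = - x) \<and>
     (\<forall>x y. br (J x) (J y) - br x y - J (br (J x) y + br x (J y)) = 0)"

definition fundamental_form :: "('a \<Rightarrow> 'a) \<Rightarrow> ('a \<Rightarrow> 'a \<Rightarrow> real) \<Rightarrow> 'a \<Rightarrow> 'a \<Rightarrow> real" where
  "fundamental_form J g x y = g (J x) y"

definition hermitian ::
    "('a::real_vector \<Rightarrow> 'a \<Rightarrow> 'a) \<Rightarrow> ('a \<Rightarrow> 'a) \<Rightarrow> ('a \<Rightarrow> 'a \<Rightarrow> real) \<Rightarrow> bool" where
  "hermitian br J g \<longleftrightarrow>
     complex_structure br J \<and> inner_product g \<and> (\<forall>x y. g (J x) (J y) = g x y)"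

definition kahler ::
    "('a::real_vector \<Rightarrow> 'a \<Rightarrow> 'a) \<Rightarrow> ('a \<Rightarrow> 'a) \<Rightarrow> ('a \<Rightarrow> 'a \<Rightarrow> real) \<Rightarrow> bool" where
  "kahler br J g \<longleftrightarrow>
     hermitian br J g \<and> (\<forall>x y z. d2 br (fundamental_form J g) x y z = 0)"

definition kahler_flat_lie_algebra ::
    "('a::real_vector \<Rightarrow> 'a \<Rightarrow> 'a) \<Rightarrow> ('a \<Rightarrow> 'a) \<Rightarrow> ('a \<Rightarrow> 'a \<Rightarrow> real) \<Rightarrow> bool" where
  "kahler_flat_lie_algebra br J g \<longleftrightarrow> lie_algebra br \<and> kahler br J g \<and> flat br g"

definition lee_form ::
    "('a::real_vector \<Rightarrow> 'a \<Rightarrow> 'a) \<Rightarrow> ('a \<Rightarrow> 'a) \<Rightarrow> ('a \<Rightarrow> 'a \<Rightarrow> real) \<Rightarrow> ('a \<Rightarrow> real) \<Rightarrow> bool" where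
  "lee_form br J g \<theta> \<longleftrightarrow>
     linear \<theta> \<and> (\<forall>x y. d1 br \<theta> x y = 0) \<and>
     (\<forall>x y z. d2 br (fundamental_form J g) x y z = wedge12 \<theta> (fundamental_form J g) x y z)"

definition vaisman ::
    "('a::real_vector \<Rightarrow> 'a \<Rightarrow> 'a) \<Rightarrow> ('a \<Rightarrow> 'a) \<Rightarrow> ('a \<Rightarrow> 'a \<Rightarrow> real) \<Rightarrow> bool" where
  "vaisman br J g \<longleftrightarrow> hermitian br J g \<and> (\<exists>\<theta>. lee_form br J g \<theta> \<and> parallel_form br g \<theta>)"

text \<open>
  The central extension by \<open>\<beta>\<close> is carried by \<open>\<real> \<times> 'a\<close>, the first factor being \<open>\<real>\<xi>\<close>.
\<close>

definition central_extension ::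
    "('a::real_vector \<Rightarrow> 'a \<Rightarrow> 'a) \<Rightarrow> ('a \<Rightarrow> 'a \<Rightarrow> real) \<Rightarrow>
     (real \<times> 'a) \<Rightarrow> (real \<times> 'a) \<Rightarrow> (real \<times> 'a)" where
  "central_extension br \<beta> u v = (\<beta> (snd u) (snd v), br (snd u) (snd v))"

text \<open>
  The semidirect product \<open>\<real> \<ltimes>\<^sub>D 'b\<close>, the generator \<open>A = (1, 0)\<close> of the first factor acting
  by \<open>[A, u] = D u\<close>.
\<close>

definition semidirect ::
    "('b \<Rightarrow> 'b) \<Rightarrow> ('b::real_vector \<Rightarrow> 'b \<Rightarrow> 'b) \<Rightarrow>
     (real \<times> 'b) \<Rightarrow> (real \<times> 'b) \<Rightarrow> (real \<times> 'b)" where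
  "semidirect D br p q = (0, fst p *\<^sub>R D (snd q) - fst q *\<^sub>R D (snd p) + br (snd p) (snd q))"

definition double_extension ::
    "('a::real_vector \<Rightarrow> 'a \<Rightarrow> 'a) \<Rightarrow> ((real \<times> 'a) \<Rightarrow> (real \<times> 'a)) \<Rightarrow> ('a \<Rightarrow> 'a \<Rightarrow> real) \<Rightarrow>
     (real \<times> real \<times> 'a) \<Rightarrow> (real \<times> real \<times> 'a) \<Rightarrow> (real \<times> real \<times> 'a)" where
  "double_extension br D \<beta> = semidirect D (central_extension br \<beta>)"

text \<open>\<open>extend_metric g\<close> is the inner product extending \<open>g\<close> for which \<open>(1, 0)\<close> is a unit vector
  orthogonal to the second factor.\<close>

definition extend_metric ::
    "('b \<Rightarrow> 'b \<Rightarrow> real) \<Rightarrow> (real \<times> 'b) \<Rightarrow> (real \<times> 'b) \<Rightarrow> real" where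
  "extend_metric g p q = fst p * fst q + g (snd p) (snd q)"

text \<open>The linear map with \<open>B \<mapsto> 0\<close> and equal to \<open>D'\<close> on \<open>'a\<close>.\<close>

definition extend_derivation :: "('a \<Rightarrow> 'a) \<Rightarrow> (real \<times> 'a) \<Rightarrow> (real \<times> 'a)" where
  "extend_derivation D' u = (0, D' (snd u))"

text \<open>With \<open>A = (1, 0, 0)\<close> and \<open>B = (0, 1, 0)\<close>: the linear map with \<open>A \<mapsto> B\<close>, \<open>B \<mapsto> - A\<close> (forced by
  \<open>J\<^sup>2 = - Id\<close>) and equal to \<open>J'\<close> on \<open>'a\<close>.\<close>

definition extend_complex :: "('a \<Rightarrow> 'a) \<Rightarrow> (real \<times> real \<times> 'a) \<Rightarrow> (real \<times> real \<times> 'a)" where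
  "extend_complex J' p = (- fst (snd p), fst p, J' (snd (snd p)))"

lemma lin_trace_eq:
  fixes f :: "'a::real_vector \<Rightarrow> 'a"
  assumes f: "linear f" and B: "finite B" "independent B" "span B = UNIV"
  shows "lin_trace f = (\<Sum>b\<in>B. representation B (f b) b)"
proof -
  define C where "C = real_vector.extend_basis ({} :: 'a set)"
  have C: "independent C" "span C = UNIV"
    unfolding C_def
    using real_vector.independent_extend_basis[of "{} :: 'a set"]
      real_vector.span_extend_basis[of "{} :: 'a set"]
    by (simp_all add: real_vector.independent_empty)
  have finC: "finite C"
    using independent_span_bound[OF B(1) C(1)] B(3) by auto
  have expand: "linear h \<Longrightarrow> h v = (\<Sum>e\<in>E. representation E v e *\<^sub>R h e)"
    if "finite E" "independent E" "span E = UNIV" for E and h :: "'a \<Rightarrow> real" and v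
  proof -
    assume h: "linear h"
    have "v = (\<Sum>e\<in>E. representation E v e *\<^sub>R e)"
      using real_vector.sum_representation_eq[of E v E] that by auto
    then have "h v = h (\<Sum>e\<in>E. representation E v e *\<^sub>R e)" by (rule arg_cong)
    then show ?thesis using h by (simp add: linear_sum linear_scale)
  qed
  have lin: "linear (\<lambda>v. representation E (f v) e)"
    if "independent E" "span E = UNIV" for E :: "'a set" and e
    using that f
    by (intro linearI)
      (simp_all add: linear_add linear_scale real_vector.representation_add
        real_vector.representation_scale)
  have lin': "linear (\<lambda>v. representation E v e)"
    if "independent E" "span E = UNIV" for E :: "'a set" and e
    using that
    by (intro linearI)
      (simp_all add: real_vector.representation_add real_vector.representation_scale)
  have "lin_trace f = (\<Sum>c\<in>C. representation C (f c) c)"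
    by (simp add: lin_trace_def C_def)
  also have "\<dots> = (\<Sum>c\<in>C. \<Sum>b\<in>B. representation B c b *\<^sub>R representation C (f b) c)"
    by (rule sum.cong[OF refl], rule expand[OF B lin[OF C]])
  also have "\<dots> = (\<Sum>b\<in>B. \<Sum>c\<in>C. representation C (f b) c *\<^sub>R representation B c b)"
    by (subst sum.swap) (simp add: mult.commute)
  also have "\<dots> = (\<Sum>b\<in>B. representation B (f b) b)"
    by (rule sum.cong[OF refl], rule expand[OF finC C lin'[OF B(2,3)], symmetric])
  finally show ?thesis .
qed

lemma riesz_span:
  fixes g :: "'a::real_vector \<Rightarrow> 'a \<Rightarrow> real"
  assumes g: "inner_product g" and "finite B" and f: "linear f"
  shows "\<exists>v\<in>span B. \<forall>z\<in>span B. g v z = f z"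
  using \<open>finite B\<close> f
proof (induction B arbitrary: f rule: finite_induct)
  case empty
  then show ?case
    using g by (auto simp: inner_product_def bilinear_rzero linear_0)
next
  case (insert b B)
  have bil: "bilinear g" and sym: "\<And>x y. g x y = g y x" and pos: "\<And>x. x \<noteq> 0 \<Longrightarrow> g x x > 0"
    using g by (auto simp: inner_product_def)
  have "linear (g b)" using bil by (simp add: bilinear_def)
  from insert.IH[OF this] obtain p where p: "p \<in> span B" "\<And>z. z \<in> span B \<Longrightarrow> g p z = g b z"
    by blast
  from insert.IH[OF insert.prems] obtain w
    where w: "w \<in> span B" "\<And>z. z \<in> span B \<Longrightarrow> g w z = f z" by blast
  define e where "e = b - p"
  have e: "g e z = 0" "g z e = 0" if "z \<in> span B" for z
    using p(2)[OF that] sym[of z e] by (simp_all add: e_def bilinear_lsub[OF bil])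
  have sub: "span B \<subseteq> span (insert b B)" by (rule span_mono) auto
  have eS: "e \<in> span (insert b B)"
    unfolding e_def using p(1) sub by (auto intro: span_diff span_base)
  have dec: "\<exists>k u. u \<in> span B \<and> z = k *\<^sub>R e + u" if "z \<in> span (insert b B)" for z
  proof -
    from that obtain k where k: "z - k *\<^sub>R b \<in> span B" by (auto simp: span_insert)
    then have "z - k *\<^sub>R b + k *\<^sub>R p \<in> span B" using p(1) by (intro span_add span_scale)
    moreover have "z = k *\<^sub>R e + (z - k *\<^sub>R b + k *\<^sub>R p)" by (simp add: e_def algebra_simps)
    ultimately show ?thesis by blast
  qed
  define v where "v = (f e / g e e) *\<^sub>R e + w"
  have "v \<in> span (insert b B)"
    unfolding v_def using eS w(1) sub by (auto intro: span_add span_scale)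
  moreover have "g v z = f z" if z: "z \<in> span (insert b B)" for z
  proof -
    obtain k u where u: "u \<in> span B" "z = k *\<^sub>R e + u" using dec[OF z] by blast
    have "f e / g e e * g e e = f e"
      using pos[of e] insert.prems by (cases "e = 0") (auto simp: linear_0)
    then show ?thesis
      using e(1)[OF u(1)] e(2)[OF w(1)] w(2)[OF u(1)] insert.prems
      by (simp add: v_def u(2) bilinear_ladd[OF bil] bilinear_radd[OF bil] bilinear_lmul[OF bil]
          bilinear_rmul[OF bil] linear_add linear_scale)
  qed
  ultimately show ?case by blast
qed

lemma levi_civita:
  fixes br :: "'a::real_vector \<Rightarrow> 'a \<Rightarrow> 'a"
  assumes L: "lie_algebra br" and g: "inner_product g"
  shows "g (nabla br g x y) z = 1/2 * (g (br x y) z - g (br y z) x + g (br z x) y)"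
proof -
  let ?f = "\<lambda>z. 1/2 * (g (br x y) z - g (br y z) x + g (br z x) y)"
  obtain B :: "'a set" where B: "finite B" "span B = UNIV" using L by (auto simp: lie_algebra_def)
  have bl: "bilinear br" and bil: "bilinear g" and pos: "\<And>x. x \<noteq> 0 \<Longrightarrow> g x x > 0"
    using L g by (auto simp: lie_algebra_def inner_product_def)
  have "linear ?f"
    by (rule linearI)
      (simp_all add: bilinear_ladd[OF bil] bilinear_radd[OF bil] bilinear_lmul[OF bil]
        bilinear_rmul[OF bil] bilinear_ladd[OF bl] bilinear_radd[OF bl] bilinear_lmul[OF bl]
        bilinear_rmul[OF bl] algebra_simps)
  from riesz_span[OF g B(1) this] obtain v where v: "\<forall>z. g v z = ?f z"
    by (auto simp: B(2))
  have uniq: "w = v" if "\<forall>z. g w z = ?f z" for w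
  proof (rule ccontr)
    assume "w \<noteq> v"
    then have "g (w - v) (w - v) > 0" using pos by simp
    moreover have "g (w - v) (w - v) = 0"
      unfolding bilinear_lsub[OF bil] by (simp only: v[rule_format] that[rule_format] diff_self)
    ultimately show False by simp
  qed
  have "\<forall>z. g (nabla br g x y) z = ?f z"
    unfolding nabla_def by (rule theI[of "\<lambda>v. \<forall>z. g v z = ?f z", OF v uniq])
  then show ?thesis by blast
qed

end

theory Submission
  imports Defs
begin

text \<open>
  Apart from solvability and unimodularity, all claims are direct computations in the coordinates
  \<open>(a, b, x)\<close> of \<open>\<real>A \<oplus> \<real>B \<oplus> \<kk>\<close>. These two rest on Milnor's structure theorem for flat metric Lie
  algebras: with \<open>L\<^sub>x = \<nabla>\<^sub>x\<close>, the kernel \<open>\<uu>\<close> of \<open>L\<close> is an abelian ideal, its orthogonal complement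
  \<open>\<bb>\<close> is an abelian subalgebra, hence \<open>[\<kk>, \<kk>] \<subseteq> \<uu>\<close>, and \<open>ad\<close> is traceless because \<open>L\<^sub>y y = 0\<close> for
  \<open>y\<close> in \<open>\<uu>\<close> or \<open>\<bb>\<close>.

  That \<open>\<bb>\<close> is abelian is usually derived from the theory of compact Lie groups. Instead, take the
  invariant form \<open>Q(x, y) = - tr (L\<^sub>x L\<^sub>y)\<close>, positive definite on \<open>\<bb>\<close>, a \<open>Q\<close>-orthonormal basis \<open>e\<^sub>i\<close> of
  \<open>\<bb>\<close> and \<open>T = \<Sum> L\<^bsub>e\<^sub>i\<^esub> e\<^sub>i\<close>. Invariance gives \<open>L\<^sub>z T = \<Sum> L\<^bsub>e\<^sub>i\<^esub> L\<^bsub>e\<^sub>i\<^esub> z\<close> for \<open>z\<close> in \<open>\<bb>\<close>, and pairing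
  with \<open>z\<close> yields \<open>\<langle>L\<^sub>z T, z\<rangle> = - \<Sum> |L\<^bsub>e\<^sub>i\<^esub> z|\<^sup>2\<close>. The left-hand side vanishes
  for \<open>z = T\<close>, so \<open>L\<^sub>x T = 0\<close> for all \<open>x\<close> in \<open>\<bb>\<close>; hence it vanishes for every \<open>z\<close> in \<open>\<bb>\<close>, so \<open>L\<^sub>x z = 0\<close> for all \<open>x, z\<close> in \<open>\<bb>\<close>.
\<close>

section \<open>Orthonormal bases and traces for an explicit bilinear form\<close>

definition orthonormal_wrt :: "('a::real_vector \<Rightarrow> 'a \<Rightarrow> real) \<Rightarrow> 'a set \<Rightarrow> bool" where
  "orthonormal_wrt g E \<longleftrightarrow> finite E \<and> (\<forall>x\<in>E. \<forall>y\<in>E. g x y = (if x = y then 1 else 0))"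

lemma orthonormal_wrt_sum:
  assumes "bilinear g" "orthonormal_wrt g E" "e \<in> E"
  shows "g (\<Sum>x\<in>E. c x *\<^sub>R x) e = c e"
proof -
  have lin: "linear (\<lambda>x. g x e)" using assms(1) by (simp add: bilinear_def)
  have "g (\<Sum>x\<in>E. c x *\<^sub>R x) e = (\<Sum>x\<in>E. c x * g x e)"
    by (simp add: linear_sum[OF lin] linear_scale[OF lin])
  also have "\<dots> = (\<Sum>x\<in>E. if x = e then c x else 0)"
    using assms(2,3) by (intro sum.cong) (auto simp: orthonormal_wrt_def)
  also have "\<dots> = c e" using assms(2,3) by (simp add: orthonormal_wrt_def)
  finally show ?thesis .
qed

lemma orthonormal_wrt_expand:
  assumes "bilinear g" "orthonormal_wrt g E" "x \<in> span E"
  shows "(\<Sum>e\<in>E. g x e *\<^sub>R e) = x"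
proof -
  have "finite E" using assms(2) by (simp add: orthonormal_wrt_def)
  then obtain c where c: "x = (\<Sum>e\<in>E. c e *\<^sub>R e)"
    using assms(3) by (auto simp: span_finite)
  show ?thesis unfolding c using orthonormal_wrt_sum[OF assms(1,2)] by (intro sum.cong) auto
qed

lemma orthonormal_wrt_independent:
  assumes "bilinear g" "orthonormal_wrt g E"
  shows "independent E"
proof -
  have fin: "finite E" using assms(2) by (simp add: orthonormal_wrt_def)
  have "c e = 0" if "(\<Sum>x\<in>E. c x *\<^sub>R x) = 0" "e \<in> E" for c e
    using orthonormal_wrt_sum[OF assms that(2), of c] that(1) bilinear_lzero[OF assms(1)] by simp
  then show ?thesis using fin by (auto simp: dependent_finite)
qed

text \<open>Gram-Schmidt. Positivity is asked only on the span in question, so that the procedure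
  also applies to a form that is definite merely on a subspace. Retaining \<open>E0\<close> allows
  an orthonormal basis of a subspace to be completed to one of the whole space.\<close>

lemma orthonormal_wrt_extend:
  fixes g :: "'a::real_vector \<Rightarrow> 'a \<Rightarrow> real"
  assumes bil: "bilinear g" and sym: "\<And>x y. g x y = g y x" and "finite S"
    and "\<And>x. x \<in> span (E0 \<union> S) \<Longrightarrow> x \<noteq> 0 \<Longrightarrow> g x x > 0" and E0: "orthonormal_wrt g E0"
  shows "\<exists>E. orthonormal_wrt g E \<and> E0 \<subseteq> E \<and> span E = span (E0 \<union> S)"
  using \<open>finite S\<close> assms(4)
proof (induction S rule: finite_induct)
  case empty
  then show ?case using E0 by auto
next
  case (insert b S)
  have sub: "span (E0 \<union> S) \<subseteq> span (E0 \<union> insert b S)" by (rule span_mono) auto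
  then obtain E where E: "orthonormal_wrt g E" "E0 \<subseteq> E" "span E = span (E0 \<union> S)"
    using insert.IH insert.prems by blast
  have span_ins: "span (insert b E) = span (E0 \<union> insert b S)"
    using span_Un[of "{b}" E] span_Un[of "{b}" "E0 \<union> S"] E(3) by simp
  define p where "p = (\<Sum>e\<in>E. g b e *\<^sub>R e)"
  define r where "r = b - p"
  have p: "p \<in> span E" unfolding p_def by (intro span_sum span_scale span_base)
  have r: "g r e = 0" if "e \<in> E" for e
    unfolding r_def p_def bilinear_lsub[OF bil] orthonormal_wrt_sum[OF bil E(1) that] by simp
  show ?case
  proof (cases "r = 0")
    case True
    then have "b \<in> span E" using p by (simp add: r_def)
    then have "span (insert b E) = span E" by (simp add: span_redundant)
    then show ?thesis using E span_ins by auto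
  next
    case False
    have "r \<in> span (insert b E)"
      unfolding r_def using p span_mono[of E "insert b E"] by (auto intro: span_diff span_base)
    then have pos: "g r r > 0" using insert.prems False span_ins by auto
    define c where "c = 1 / sqrt (g r r)"
    define e where "e = c *\<^sub>R r"
    have c: "c \<noteq> 0" "c * c * g r r = 1" using pos by (simp_all add: c_def)
    have "g e e = 1"
      using c(2) by (simp add: e_def bilinear_lmul[OF bil] bilinear_rmul[OF bil] mult.assoc)
    moreover have ex: "g e x = 0" "g x e = 0" if "x \<in> E" for x
      using r[OF that] sym[of x e] by (simp_all add: e_def bilinear_lmul[OF bil])
    ultimately have "orthonormal_wrt g (insert e E)"
      using E(1) unfolding orthonormal_wrt_def by fastforce
    moreover have "span (insert e E) = span (insert b E)"
    proof (rule span_eq[THEN iffD2], intro conjI subsetI)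
      fix x assume "x \<in> insert e E"
      then show "x \<in> span (insert b E)"
        using \<open>r \<in> span (insert b E)\<close> by (auto simp: e_def intro: span_scale span_base)
    next
      fix x assume x: "x \<in> insert b E"
      have "b = (1 / c) *\<^sub>R e + p" using c(1) by (simp add: e_def r_def)
      moreover have "p \<in> span (insert e E)" using p span_mono[of E "insert e E"] by auto
      ultimately have "b \<in> span (insert e E)"
        by (metis insertI1 span_add span_base span_scale)
      then show "x \<in> span (insert e E)" using x by (auto intro: span_base)
    qed
    ultimately show ?thesis using E(2) span_ins by (intro exI[of _ "insert e E"]) auto
  qed
qed

text \<open>The coefficient of \<open>v\<close> at a basis vector \<open>e\<close> is
  \<open>g v e\<close>, so the diagonal entries can be read off from \<open>g\<close>.\<close>

lemma lin_trace_orthonormal: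
  assumes "linear f" "bilinear g" "orthonormal_wrt g E" "span E = UNIV"
  shows "lin_trace f = (\<Sum>e\<in>E. g (f e) e)"
proof -
  have fin: "finite E" using assms(3) by (simp add: orthonormal_wrt_def)
  have ind: "independent E" by (rule orthonormal_wrt_independent[OF assms(2,3)])
  have "representation E v e = g v e" if "e \<in> E" for v e
    using orthonormal_wrt_sum[OF assms(2,3) that, of "representation E v"]
      real_vector.sum_representation_eq[OF ind, of v E] fin assms(4) by simp
  then show ?thesis
    unfolding lin_trace_eq[OF assms(1) fin ind assms(4)] by (intro sum.cong) auto
qed

lemma span_insert_Pair:
  fixes S :: "'b::real_vector set"
  assumes "span S = UNIV"
  shows "span (insert (1, 0) (Pair 0 ` S)) = (UNIV :: (real \<times> 'b) set)"
proof -
  let ?T = "insert (1, 0) (Pair 0 ` S) :: (real \<times> 'b) set"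
  have lin: "linear (Pair (0::real) :: 'b \<Rightarrow> _)" by (rule linearI) simp_all
  have "(a, v) \<in> span ?T" for a v
  proof -
    have "(0, v) \<in> Pair 0 ` span S" by (simp only: assms) blast
    then have "(0, v) \<in> span (Pair (0::real) ` S)" by (simp only: linear_span_image[OF lin])
    moreover have "span (Pair 0 ` S) \<subseteq> span ?T" by (rule span_mono) blast
    ultimately have "(0, v) \<in> span ?T" by blast
    moreover have "a *\<^sub>R (1, 0) \<in> span ?T" by (intro span_scale span_base insertI1)
    ultimately have "a *\<^sub>R (1, 0) + (0, v) \<in> span ?T" by (rule span_add[rotated])
    then show ?thesis by simp
  qed
  then show ?thesis by fast
qed

text \<open>Serves to contract something skew with something symmetric: once for the trace of a skew
  operator times a symmetric one, once for skew coefficients of a symmetric vector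
  expression.\<close>

lemma sum_antisymmetric_eq_0:
  fixes h :: "'b \<Rightarrow> 'b \<Rightarrow> 'c::real_vector"
  assumes "\<And>i j. i \<in> E \<Longrightarrow> j \<in> E \<Longrightarrow> h j i = - h i j"
  shows "(\<Sum>i\<in>E. \<Sum>j\<in>E. h i j) = 0"
proof -
  have "(\<Sum>i\<in>E. \<Sum>j\<in>E. h i j) = (\<Sum>j\<in>E. \<Sum>i\<in>E. h i j)" by (rule sum.swap)
  also have "\<dots> = - (\<Sum>j\<in>E. \<Sum>i\<in>E. h j i)"
    unfolding sum_negf[symmetric] by (intro sum.cong refl assms)
  finally have "(\<Sum>i\<in>E. \<Sum>j\<in>E. h i j) + (\<Sum>i\<in>E. \<Sum>j\<in>E. h i j) = 0"
    by (simp only: eq_neg_iff_add_eq_0)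
  then show ?thesis by (simp only: scaleR_2[symmetric]) simp
qed

section \<open>Flat metric Lie algebras: the Levi-Civita connection and the splitting it
  induces\<close>

locale flat_lie_algebra =
  fixes br :: "'a::real_vector \<Rightarrow> 'a \<Rightarrow> 'a" and g :: "'a \<Rightarrow> 'a \<Rightarrow> real"
  assumes lie: "lie_algebra br" and inner: "inner_product g" and flat: "flat br g"
begin

abbreviation "L \<equiv> nabla br g"

lemma bil_g: "bilinear g" and sym_g: "g x y = g y x" and pos_g: "x \<noteq> 0 \<Longrightarrow> g x x > 0"
  using inner by (auto simp: inner_product_def)

lemma bil_br: "bilinear br" and br_self: "br x x = 0"
  using lie by (auto simp: lie_algebra_def)

lemmas g_simps = bilinear_ladd[OF bil_g] bilinear_radd[OF bil_g] bilinear_lmul[OF bil_g]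
  bilinear_rmul[OF bil_g] bilinear_lsub[OF bil_g] bilinear_rsub[OF bil_g]
  bilinear_lneg[OF bil_g] bilinear_rneg[OF bil_g] bilinear_lzero[OF bil_g] bilinear_rzero[OF bil_g]

lemmas br_simps = bilinear_ladd[OF bil_br] bilinear_radd[OF bil_br] bilinear_lmul[OF bil_br]
  bilinear_rmul[OF bil_br] bilinear_lsub[OF bil_br] bilinear_rsub[OF bil_br]
  bilinear_lneg[OF bil_br] bilinear_rneg[OF bil_br] bilinear_lzero[OF bil_br] bilinear_rzero[OF bil_br]

lemma br_anti: "br y x = - br x y"
proof -
  have "br y x + br x y = br (x + y) (x + y)"
    unfolding bilinear_ladd[OF bil_br] bilinear_radd[OF bil_br] by (simp add: br_self)
  then have "br y x + br x y = 0" by (simp only: br_self)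
  then show ?thesis by (simp only: eq_neg_iff_add_eq_0)
qed

lemma g_br_anti: "g (br y x) z = - g (br x y) z"
  by (subst br_anti) (rule bilinear_lneg[OF bil_g])

lemma g_eq_0D: "g x x = 0 \<Longrightarrow> x = 0"
  using pos_g by force

lemma g_nonneg: "g x x \<ge> 0"
  using pos_g[of x] by (cases "x = 0") (auto simp: g_simps)

lemma g_eqI:
  assumes "\<And>z. g v z = g w z" shows "v = w"
proof -
  have "g (v - w) (v - w) = 0" by (simp only: bilinear_lsub[OF bil_g] assms diff_self)
  then show ?thesis using g_eq_0D[of "v - w"] by simp
qed

lemmas L_g = levi_civita[OF lie inner]

lemma bil_L: "bilinear L"
  unfolding bilinear_def
  by (intro conjI allI linearI; rule g_eqI)
    (simp_all add: L_g g_simps br_simps algebra_simps)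

lemmas L_simps = bilinear_ladd[OF bil_L] bilinear_radd[OF bil_L] bilinear_lmul[OF bil_L]
  bilinear_rmul[OF bil_L] bilinear_lsub[OF bil_L] bilinear_rsub[OF bil_L]
  bilinear_lneg[OF bil_L] bilinear_rneg[OF bil_L] bilinear_lzero[OF bil_L] bilinear_rzero[OF bil_L]

lemma L_skew: "g (L x y) z = - g y (L x z)"
  unfolding sym_g[of y "L x z"] L_g
  using g_br_anti[of x y z] g_br_anti[of x z y] g_br_anti[of y z x] by argo

lemma L_skew_self: "g (L x y) y = 0"
  using L_skew[of x y y] sym_g[of y "L x y"] by simp

lemma L_torsion: "L x y - L y x = br x y"
proof (rule g_eqI)
  fix z
  show "g (L x y - L y x) z = g (br x y) z"
    unfolding bilinear_lsub[OF bil_g] L_g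
    using g_br_anti[of x y z] g_br_anti[of x z y] g_br_anti[of y z x] by argo
qed

text \<open>Vanishing curvature means precisely that \<open>L\<close> is a representation of the Lie
  algebra.\<close>

lemma L_br: "L (br x y) z = L x (L y z) - L y (L x z)"
  using flat[unfolded flat_def curvature_def, rule_format, of x y z] by simp

text \<open>\<open>trans_ideal\<close> is the \<uu> and \<open>rot_part\<close> the \<bb> of the
  overview. In the affine action where \<open>x\<close> has linear part \<open>L x\<close> and
  translation part \<open>x\<close>, the elements of \<uu> are the pure translations.\<close>

definition "trans_ideal = {x. \<forall>y. L x y = 0}"

definition "rot_part = {x. \<forall>y\<in>trans_ideal. g x y = 0}"

lemma subspace_trans_ideal: "subspace trans_ideal"
  by (auto simp: subspace_def trans_ideal_def L_simps)

lemma subspace_rot_part: "subspace rot_part"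
  by (auto simp: subspace_def rot_part_def g_simps)

lemma L_trans_ideal: "y \<in> trans_ideal \<Longrightarrow> L x y = br x y"
  using L_torsion[of x y] by (simp add: trans_ideal_def)

lemma br_trans_ideal: "y \<in> trans_ideal \<Longrightarrow> br x y \<in> trans_ideal"
  by (simp add: trans_ideal_def L_br L_simps)

lemma br_trans_ideal_abelian: "x \<in> trans_ideal \<Longrightarrow> y \<in> trans_ideal \<Longrightarrow> br x y = 0"
  using L_torsion[of x y] by (simp add: trans_ideal_def)

text \<open>On \<uu> the operator \<open>L x\<close> is \<open>br x\<close>, which preserves the
  ideal \<uu>; being skew, \<open>L x\<close> also preserves the orthogonal complement.\<close>

lemma L_rot_part: "y \<in> rot_part \<Longrightarrow> L x y \<in> rot_part"
  using L_trans_ideal br_trans_ideal by (auto simp: rot_part_def L_skew)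

lemma br_rot_part: "x \<in> rot_part \<Longrightarrow> y \<in> rot_part \<Longrightarrow> br x y \<in> rot_part"
  using L_rot_part subspace_diff[OF subspace_rot_part] L_torsion[of x y] by metis

lemma trans_rot_disjoint:
  assumes "x \<in> rot_part" "\<And>y. L x y = 0" shows "x = 0"
  using assms g_eq_0D[of x] by (auto simp: rot_part_def trans_ideal_def)

lemma finite_spanning_subset:
  fixes V :: "'a set"
  assumes "subspace V"
  obtains S where "finite S" "span S = V"
proof -
  obtain B :: "'a set" where B: "finite B" "span B = UNIV" using lie by (auto simp: lie_algebra_def)
  obtain S where S: "S \<subseteq> V" "independent S" "V \<subseteq> span S"
    using real_vector.maximal_independent_subset[of V] by blast
  have "finite S" using independent_span_bound[OF B(1) S(2)] B(2) by auto
  moreover have "span S = V" using S span_minimal[OF S(1) assms] by auto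
  ultimately show ?thesis using that by blast
qed

text \<open>Gram-Schmidt is run twice, first inside \<uu> and then on the whole space. The vectors
  added in the second run are orthogonal to a basis of \<uu>, hence lie in \<bb>.\<close>

lemma adapted_basis:
  obtains E where "orthonormal_wrt g E" "span E = UNIV" "E \<subseteq> trans_ideal \<union> rot_part"
proof -
  obtain S where S: "finite S" "span S = trans_ideal"
    using finite_spanning_subset[OF subspace_trans_ideal] .
  obtain B :: "'a set" where B: "finite B" "span B = UNIV" using lie by (auto simp: lie_algebra_def)
  obtain E0 where E0: "orthonormal_wrt g E0" "span E0 = trans_ideal"
    using orthonormal_wrt_extend[OF bil_g sym_g S(1), of "{}"] pos_g S(2)
    by (auto simp: orthonormal_wrt_def)
  obtain E where E: "orthonormal_wrt g E" "E0 \<subseteq> E" "span E = span (E0 \<union> B)"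
    using orthonormal_wrt_extend[OF bil_g sym_g B(1), of E0] pos_g E0(1) by auto
  have "e \<in> rot_part" if "e \<in> E" "e \<notin> E0" for e
  proof -
    have "g e y = 0" if "y \<in> span E0" for y
      using that
    proof (induction rule: span_induct)
      case base
      show ?case by (auto simp: subspace_def g_simps)
    next
      case (step x)
      then show ?case using E(1,2) \<open>e \<in> E\<close> \<open>e \<notin> E0\<close> by (auto simp: orthonormal_wrt_def)
    qed
    then show ?thesis using E0(2) by (simp add: rot_part_def)
  qed
  moreover have "E0 \<subseteq> trans_ideal" using E0(2) span_superset by blast
  moreover have "span (E0 \<union> B) = UNIV" using B(2) span_mono[of B "E0 \<union> B"] by auto
  ultimately show ?thesis using that[of E] E by auto
qed

lemma trans_rot_decomp:
  obtains u b where "x = u + b" "u \<in> trans_ideal" "b \<in> rot_part"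
proof -
  obtain E where E: "span E = UNIV" "E \<subseteq> trans_ideal \<union> rot_part" using adapted_basis by metis
  have "x \<in> span (trans_ideal \<union> rot_part)" using E span_mono[OF E(2)] by auto
  then show ?thesis
    using that span_Un[of trans_ideal rot_part] subspace_trans_ideal subspace_rot_part
    by (auto simp: span_eq_iff[THEN iffD2])
qed

section \<open>The complement \<bb> is abelian\<close>

lemma invariant_form:
  obtains Q :: "'a \<Rightarrow> 'a \<Rightarrow> real"
  where "bilinear Q" "\<And>x y. Q x y = Q y x" "\<And>x. x \<in> rot_part \<Longrightarrow> x \<noteq> 0 \<Longrightarrow> Q x x > 0"
    "\<And>x y z. Q (br y x) z = - Q x (br y z)"
proof -
  obtain E where E: "orthonormal_wrt g E" "span E = UNIV" using adapted_basis by metis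
  have fin: "finite E" using E(1) by (simp add: orthonormal_wrt_def)
  \<comment> \<open>As \<open>L x\<close> is skew, this is the negative trace of \<open>L x\<close>
    composed with \<open>L y\<close>. Written as a sum of inner products it is visibly nonnegative
    for \<open>x = y\<close>; a zero of it lies in the kernel of \<open>L\<close>, which meets \<bb>
    only in 0.\<close>
  define Q where "Q x y = (\<Sum>e\<in>E. g (L x e) (L y e))" for x y
  have "bilinear Q"
    unfolding bilinear_def Q_def
    by (intro conjI allI linearI)
      (simp_all add: L_simps g_simps sum.distrib sum_distrib_left)
  moreover have "Q x y = Q y x" for x y
    unfolding Q_def by (intro sum.cong refl sym_g)
  moreover have "Q x x > 0" if "x \<in> rot_part" "x \<noteq> 0" for x
  proof (rule ccontr)
    assume "\<not> Q x x > 0"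
    moreover have "Q x x \<ge> 0" unfolding Q_def by (intro sum_nonneg g_nonneg)
    ultimately have "(\<Sum>e\<in>E. g (L x e) (L x e)) = 0" unfolding Q_def by linarith
    then have E0: "L x e = 0" if "e \<in> E" for e
      using that g_eq_0D sum_nonneg_eq_0_iff[OF fin g_nonneg] by blast
    have "L x y = 0" if "y \<in> span E" for y
      using that by (induction rule: span_induct) (auto simp: subspace_def L_simps E0)
    then have "x = 0" using E(2) by (intro trans_rot_disjoint[OF that(1)]) simp
    then show False using that(2) by contradiction
  qed
  moreover have "Q (br y x) z = - Q x (br y z)" for x y z
  proof -
    \<comment> \<open>An anticommutator of skew operators is symmetric. Expanding the brackets by
      \<open>L_br\<close> and shifting skew operators across \<open>g\<close> turns the invariance
      defect of \<open>Q\<close> into the trace pairing of the skew \<open>L y\<close> with the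
      symmetric \<open>?S\<close>, which vanishes.\<close>
    let ?S = "\<lambda>v. L x (L z v) + L z (L x v)"
    have expand: "g v w = (\<Sum>e\<in>E. g v e * g w e)" for v w
    proof -
      have lin: "linear (g v)" using bil_g by (simp add: bilinear_def)
      have "g v w = g v (\<Sum>e\<in>E. g w e *\<^sub>R e)"
        using orthonormal_wrt_expand[OF bil_g E(1)] E(2) by simp
      then show ?thesis by (simp add: linear_sum[OF lin] linear_scale[OF lin] mult.commute)
    qed
    have "Q (br y x) z + Q x (br y z) = (\<Sum>e\<in>E. g (L y e) (?S e))"
      unfolding Q_def sum.distrib[symmetric]
    proof (rule sum.cong[OF refl])
      fix e
      show "g (L (br y x) e) (L z e) + g (L x e) (L (br y z) e) = g (L y e) (?S e)"
        unfolding L_br g_simps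
        using L_skew[of y "L x e" "L z e"] L_skew[of x "L y e" "L z e"] L_skew[of z "L y e" "L x e"]
          sym_g[of "L x e" "L z (L y e)"]
        by linarith
    qed
    also have "\<dots> = (\<Sum>e\<in>E. \<Sum>f\<in>E. g (L y e) f * g (?S e) f)"
      by (intro sum.cong refl expand)
    also have "\<dots> = 0"
    proof (rule sum_antisymmetric_eq_0)
      fix e f
      have "g (?S f) e = g (?S e) f"
        unfolding g_simps
        using L_skew[of x "L z f" e] L_skew[of z "L x f" e] L_skew[of z f "L x e"]
          L_skew[of x f "L z e"] sym_g[of f "L x (L z e)"] sym_g[of f "L z (L x e)"]
        by linarith
      moreover have "g (L y f) e = - g (L y e) f" using L_skew[of y f e] sym_g[of f "L y e"] by simp
      ultimately show "g (L y f) e * g (?S f) e = - (g (L y e) f * g (?S e) f)" by simp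
    qed
    finally show ?thesis by linarith
  qed
  ultimately show ?thesis by (rule that)
qed

lemma L_rot_part_eq_0:
  assumes "x \<in> rot_part" "y \<in> rot_part" shows "L x y = 0"
proof -
  obtain Q :: "'a \<Rightarrow> 'a \<Rightarrow> real" where Q: "bilinear Q" "\<And>x y. Q x y = Q y x"
    "\<And>x. x \<in> rot_part \<Longrightarrow> x \<noteq> 0 \<Longrightarrow> Q x x > 0" "\<And>x y z. Q (br y x) z = - Q x (br y z)"
    using invariant_form by metis
  obtain S where S: "finite S" "span S = rot_part"
    using finite_spanning_subset[OF subspace_rot_part] .
  obtain E where E: "orthonormal_wrt Q E" "span E = rot_part"
    using orthonormal_wrt_extend[OF Q(1,2) S(1), of "{}"] Q(3) S(2)
    by (auto simp: orthonormal_wrt_def)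
  have fin: "finite E" using E(1) by (simp add: orthonormal_wrt_def)
  have rot: "e \<in> rot_part" if "e \<in> E" for e using E(2) that span_superset by blast
  define T where "T = (\<Sum>e\<in>E. L e e)"
  have T: "T \<in> rot_part"
    unfolding T_def by (intro subspace_sum[OF subspace_rot_part] L_rot_part rot)
  \<comment> \<open>Moving \<open>L z\<close> past \<open>L e\<close> and applying torsion-freeness
    produces the right-hand side plus terms containing \<open>br z e\<close>. Expanded in
    \<open>E\<close>, these cancel: \<open>Q (br z e) f\<close> is skew in \<open>e\<close> and
    \<open>f\<close> by invariance, and \<open>L f e + L e f\<close> is symmetric.\<close>
  have cas: "L z T = (\<Sum>e\<in>E. L e (L e z))" if z: "z \<in> rot_part" for z
  proof -
    have br_expand: "(\<Sum>f\<in>E. Q (br z e) f *\<^sub>R f) = br z e" if "e \<in> E" for e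
      by (rule orthonormal_wrt_expand[OF Q(1) E(1)]) (simp add: E(2) br_rot_part z rot that)
    have "(\<Sum>e\<in>E. L (br z e) e + L e (br z e))
        = (\<Sum>e\<in>E. \<Sum>f\<in>E. Q (br z e) f *\<^sub>R (L f e + L e f))"
    proof (rule sum.cong[OF refl])
      fix e assume e: "e \<in> E"
      have l: "linear (\<lambda>v. L v e)" "linear (L e)" using bil_L by (simp_all add: bilinear_def)
      show "L (br z e) e + L e (br z e) = (\<Sum>f\<in>E. Q (br z e) f *\<^sub>R (L f e + L e f))"
        by (subst (1 2) br_expand[OF e, symmetric])
          (simp add: linear_sum[OF l(1)] linear_sum[OF l(2)] L_simps sum.distrib scaleR_add_right)
    qed
    also have "\<dots> = 0"
    proof (rule sum_antisymmetric_eq_0)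
      fix e f
      have "Q (br z f) e = - Q (br z e) f" using Q(4)[of z f e] Q(2)[of f] by simp
      then show "Q (br z f) e *\<^sub>R (L e f + L f e) = - (Q (br z e) f *\<^sub>R (L f e + L e f))"
        by (simp add: add.commute)
    qed
    finally have inv: "(\<Sum>e\<in>E. L (br z e) e + L e (br z e)) = 0" .
    have l: "linear (L z)" using bil_L by (simp add: bilinear_def)
    have "L z T = (\<Sum>e\<in>E. L z (L e e))" unfolding T_def by (rule linear_sum[OF l])
    also have "\<dots> = (\<Sum>e\<in>E. (L (br z e) e + L e (br z e)) + L e (L e z))"
      unfolding L_br by (intro sum.cong refl) (simp add: L_torsion[symmetric] L_simps)
    also have "\<dots> = (\<Sum>e\<in>E. L e (L e z))" using inv by (simp add: sum.distrib)
    finally show ?thesis .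
  qed
  \<comment> \<open>Pairing \<open>cas\<close> with \<open>z\<close> and using skewness gives minus
    a sum of squared norms, so every summand vanishes with the total.\<close>
  have key: "L e z = 0" if z: "z \<in> rot_part" "g (L z T) z = 0" and e: "e \<in> E" for z e
  proof -
    have l: "linear (\<lambda>v. g v z)" using bil_g by (simp add: bilinear_def)
    have "0 = (\<Sum>e\<in>E. g (L e (L e z)) z)"
      using z by (simp add: cas linear_sum[OF l])
    also have "\<dots> = - (\<Sum>e\<in>E. g (L e z) (L e z))"
      unfolding sum_negf[symmetric] by (intro sum.cong refl L_skew)
    finally have "(\<Sum>e\<in>E. g (L e z) (L e z)) = 0" by simp
    then have "\<forall>e\<in>E. g (L e z) (L e z) = 0"
      by (simp only: sum_nonneg_eq_0_iff[OF fin g_nonneg])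
    from bspec[OF this e] show ?thesis by (rule g_eq_0D)
  qed
  have ext: "L w z = 0" if "\<And>e. e \<in> E \<Longrightarrow> L e z = 0" "w \<in> rot_part" for w z
    using that(2) unfolding E(2)[symmetric]
    by (induction rule: span_induct) (auto simp: subspace_def L_simps that(1))
  \<comment> \<open>\<open>key\<close> is used twice: for \<open>z = T\<close>, where skewness
    supplies its premise, and then for \<open>z = y\<close>, where the premise follows from
    \<open>L y T = 0\<close> just obtained.\<close>
  have "L w T = 0" if "w \<in> rot_part" for w
    using ext[OF key[OF T L_skew_self] that] .
  then have "L e y = 0" if "e \<in> E" for e
    using key[OF assms(2) _ that] assms(2) by (simp add: g_simps)
  then show ?thesis using ext assms(1) by blast
qed

section \<open>Consequences of the splitting: commutators and traces\<close>

lemma br_in_trans_ideal: "br x y \<in> trans_ideal"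
proof -
  obtain u b where x: "x = u + b" "u \<in> trans_ideal" "b \<in> rot_part" using trans_rot_decomp .
  obtain v c where y: "y = v + c" "v \<in> trans_ideal" "c \<in> rot_part" using trans_rot_decomp .
  have "br b c = 0"
    using L_torsion[of b c] L_rot_part_eq_0 x(3) y(3) by simp
  then have "br x y = br x v - br c u"
    using br_anti[of u c] by (simp add: x(1) y(1) br_simps)
  then show ?thesis using br_trans_ideal subspace_diff[OF subspace_trans_ideal] x(2) y(2) by simp
qed

text \<open>Each summand vanishes separately: by torsion-freeness and skewness
  \<open>g (br x e) e\<close> equals \<open>g x (L e e)\<close>, and \<open>L e e = 0\<close> on an
  adapted basis. The basis itself is exported because it is extended later to one of the double
  extension.\<close>

lemma traceless_basis:
  obtains E where "orthonormal_wrt g E" "span E = UNIV" "\<And>x. (\<Sum>e\<in>E. g (br x e) e) = 0"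
proof -
  obtain E where E: "orthonormal_wrt g E" "span E = UNIV" "E \<subseteq> trans_ideal \<union> rot_part"
    using adapted_basis .
  have "g (br x e) e = 0" if "e \<in> E" for x e
  proof -
    have "L e e = 0" using E(3) that L_rot_part_eq_0 by (auto simp: trans_ideal_def)
    then show ?thesis
      using L_skew[of e x e] L_skew_self[of x e] by (simp add: L_torsion[symmetric] g_simps)
  qed
  then show ?thesis using that E(1,2) by simp
qed

end

section \<open>The data of the double extension and identities on \<kk>\<close>

locale kahler_flat_double_extension =
  fixes br :: "'a::real_vector \<Rightarrow> 'a \<Rightarrow> 'a" and J' D' :: "'a \<Rightarrow> 'a" and g' :: "'a \<Rightarrow> 'a \<Rightarrow> real"
  assumes kflat: "kahler_flat_lie_algebra br J' g'" and der: "lie_derivation br D'"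
    and skew: "skew_symmetric g' D'" and comm: "\<forall>x. J' (D' x) = D' (J' x)"

sublocale kahler_flat_double_extension \<subseteq> flat_lie_algebra br g'
  using kflat by unfold_locales (auto simp: kahler_flat_lie_algebra_def kahler_def hermitian_def)

context kahler_flat_double_extension
begin

abbreviation "\<omega>' \<equiv> fundamental_form J' g'"
abbreviation "D \<equiv> extend_derivation D'"
abbreviation "\<gg> \<equiv> double_extension br D \<omega>'"
abbreviation "J \<equiv> extend_complex J'"
text \<open>From here on \<open>g\<close> is the inner product of the extension, whereas the
  inherited facts \<open>g_simps\<close>, \<open>sym_g\<close> and \<open>pos_g\<close> concern
  \<open>g'\<close> on \<kk>.\<close>

abbreviation "g \<equiv> extend_metric (extend_metric g')"
abbreviation "\<theta> \<equiv> \<lambda>x::real \<times> real \<times> 'a. g (1, 0, 0) x"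

lemma bracket_eq:
  "\<gg> (a, b, x) (c, d, y) = (0, g' (J' x) y, a *\<^sub>R D' y - c *\<^sub>R D' x + br x y)"
  by (simp add: double_extension_def semidirect_def central_extension_def extend_derivation_def
      fundamental_form_def)

lemma g_eq: "g (a, b, x) (c, d, y) = a * c + (b * d + g' x y)"
  by (simp add: extend_metric_def)

lemma J_eq: "J (a, b, x) = (- b, a, J' x)"
  by (simp add: extend_complex_def)

lemma \<theta>_eq: "\<theta> (a, b, x) = a"
  by (simp add: g_eq g_simps)

lemma linear_J': "linear J'" and J'_J': "J' (J' x) = - x"
  and g'_J'_J': "g' (J' x) (J' y) = g' x y"
  and integrable_J': "br (J' x) (J' y) - br x y - J' (br (J' x) y + br x (J' y)) = 0"
  and closed_\<omega>': "d2 br \<omega>' x y z = 0"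
  using kflat by (auto simp: kahler_flat_lie_algebra_def kahler_def hermitian_def complex_structure_def)

lemma linear_D': "linear D'" and D'_br: "D' (br x y) = br (D' x) y + br x (D' y)"
  using der by (auto simp: lie_derivation_def)

lemmas lin_simps = linear_add[OF linear_J'] linear_diff[OF linear_J'] linear_scale[OF linear_J']
  linear_neg[OF linear_J'] linear_0[OF linear_J'] linear_add[OF linear_D'] linear_diff[OF linear_D']
  linear_scale[OF linear_D'] linear_neg[OF linear_D'] linear_0[OF linear_D']

lemma D'_skew: "g' (D' x) y = - g' x (D' y)"
  using skew by (simp add: skew_symmetric_def)

lemma \<omega>'_J': "g' (J' x) y = - g' x (J' y)"
  using g'_J'_J'[of x "J' y"] by (simp add: J'_J' g_simps)

lemma \<omega>'_anti: "g' (J' y) x = - g' (J' x) y"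
  using \<omega>'_J'[of y x] sym_g[of y "J' x"] by simp

lemma \<omega>'_self: "g' (J' x) x = 0"
  using \<omega>'_anti[of x x] by simp

text \<open>\<open>D'\<close> preserves \<open>\<omega>'\<close> infinitesimally. This is the
  B-component of the derivation rule for \<open>D\<close>, which kills B.\<close>

lemma \<omega>'_D': "g' (J' (D' x)) y + g' (J' x) (D' y) = 0"
  using D'_skew[of "J' x" y] comm by simp

text \<open>The product of the commuting skew operators \<open>J'\<close> and \<open>D'\<close> is
  symmetric. This cancels the \<open>D'\<close> terms in the Jacobi identity and in the differential
  of the fundamental form.\<close>

lemma \<omega>'_D'_sym: "g' (J' (D' x)) y = g' (J' (D' y)) x" "g' (J' x) (D' y) = g' (J' y) (D' x)"
  using \<omega>'_D'[of x y] \<omega>'_D'[of y x] \<omega>'_anti[of x "D' y"] \<omega>'_anti[of y "D' x"] by simp_all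

lemma jacobi: "br x (br y z) + br y (br z x) + br z (br x y) = 0"
  using lie by (auto simp: lie_algebra_def)

text \<open>Closedness in cyclic form, which is the central component of the Jacobi
  identity.\<close>

lemma \<omega>'_cocycle: "g' (J' x) (br y z) + g' (J' y) (br z x) + g' (J' z) (br x y) = 0"
  using closed_\<omega>'[of x y z] \<omega>'_anti[of "br x y" z] \<omega>'_anti[of "br x z" y] \<omega>'_anti[of "br y z" x]
    br_anti[of z x]
  by (simp add: d2_def fundamental_form_def g_simps)

section \<open>The central and the double extension as Lie algebras, and the extended inner
  product\<close>

lemma lie_algebra_central_extension: "lie_algebra (central_extension br \<omega>')"
proof -
  obtain S :: "'a set" where S: "finite S" "span S = UNIV" using lie by (auto simp: lie_algebra_def)
  show ?thesis
    unfolding lie_algebra_def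
  proof (intro conjI allI)
    show "\<exists>B. finite B \<and> span B = (UNIV :: (real \<times> 'a) set)"
      by (rule exI[of _ "insert (1, 0) (Pair 0 ` S)"]) (simp add: S(1) span_insert_Pair S(2))
    show "bilinear (central_extension br \<omega>')"
      unfolding bilinear_def
      by (intro conjI allI linearI)
        (simp_all add: central_extension_def fundamental_form_def lin_simps g_simps br_simps)
  next
    fix x :: "real \<times> 'a"
    show "central_extension br \<omega>' x x = 0"
      by (simp add: central_extension_def fundamental_form_def \<omega>'_self br_self zero_prod_def)
  next
    fix x y z :: "real \<times> 'a"
    let ?b = "central_extension br \<omega>'"
    show "?b x (?b y z) + ?b y (?b z x) + ?b z (?b x y) = 0"
      by (simp add: central_extension_def fundamental_form_def jacobi \<omega>'_cocycle zero_prod_def)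
  qed
qed

lemma lie_derivation_D: "lie_derivation (central_extension br \<omega>') D"
  unfolding lie_derivation_def
proof (intro conjI allI linearI)
  fix u v :: "real \<times> 'a"
  show "D (central_extension br \<omega>' u v)
      = central_extension br \<omega>' (D u) v + central_extension br \<omega>' u (D v)"
    using \<omega>'_D'[of "snd u" "snd v"]
    by (simp add: extend_derivation_def central_extension_def fundamental_form_def D'_br)
qed (simp_all add: extend_derivation_def lin_simps)

lemma skew_symmetric_D: "skew_symmetric (extend_metric g') D"
  by (simp add: skew_symmetric_def extend_metric_def extend_derivation_def D'_skew)

lemma inner_product_g: "inner_product g"
  unfolding inner_product_def
proof (intro conjI allI impI)
  show "bilinear g"
    unfolding bilinear_def
    by (intro conjI allI linearI) (simp_all add: extend_metric_def g_simps algebra_simps)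
next
  fix x y :: "real \<times> real \<times> 'a"
  show "g x y = g y x"
    using sym_g[of "snd (snd x)" "snd (snd y)"] by (simp add: extend_metric_def mult.commute)
next
  fix x :: "real \<times> real \<times> 'a"
  assume nz: "x \<noteq> 0"
  obtain a b v where x: "x = (a, b, v)" by (cases x)
  show "g x x > 0"
  proof (cases "v = 0")
    case True
    then have "a \<noteq> 0 \<or> b \<noteq> 0" using nz x by (auto simp: zero_prod_def)
    then show ?thesis using True by (auto simp: x g_eq g_simps sum_squares_gt_zero_iff)
  next
    case False
    then show ?thesis
      using pos_g[OF False] unfolding x g_eq by (intro add_nonneg_pos) simp_all
  qed
qed

lemma bilinear_g: "bilinear g"
  using inner_product_g by (simp add: inner_product_def)

lemma sym_extended_g: "g x y = g y x"
  using inner_product_g by (simp only: inner_product_def)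

lemma bilinear_\<gg>: "bilinear \<gg>"
  unfolding bilinear_def
  by (intro conjI allI linearI)
    (simp_all add: double_extension_def semidirect_def central_extension_def extend_derivation_def
      fundamental_form_def lin_simps g_simps br_simps algebra_simps)

lemma span_extension:
  assumes "span S = (UNIV :: 'a set)"
  shows "span ({(1, 0, 0), (0, 1, 0)} \<union> (\<lambda>v. (0, 0, v)) ` S) = (UNIV :: (real \<times> real \<times> 'a) set)"
  unfolding Un_insert_left Un_empty_left
  using span_insert_Pair[of "insert (1, 0) (Pair 0 ` S)"] span_insert_Pair[OF assms]
  by (simp add: image_image zero_prod_def)

lemma lie_algebra_\<gg>: "lie_algebra \<gg>"
proof -
  obtain S :: "'a set" where S: "finite S" "span S = UNIV" using lie by (auto simp: lie_algebra_def)
  show ?thesis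
    unfolding lie_algebra_def
  proof (intro conjI allI bilinear_\<gg>)
    show "\<exists>B. finite B \<and> span B = (UNIV :: (real \<times> real \<times> 'a) set)"
      using span_extension[OF S(2)] S(1) by (intro exI conjI) auto
  next
    fix x :: "real \<times> real \<times> 'a"
    show "\<gg> x x = 0"
      by (cases x) (simp add: bracket_eq \<omega>'_self br_self zero_prod_def)
  next
    fix x y z :: "real \<times> real \<times> 'a"
    obtain a b u where x: "x = (a, b, u)" by (cases x)
    obtain c d v where y: "y = (c, d, v)" by (cases y)
    obtain e f w where z: "z = (e, f, w)" by (cases z)
    \<comment> \<open>The B-component of the Jacobi identity: the cocycle identity removes the
      brackets of \<kk>, and the rest is grouped by \<open>a\<close>, \<open>c\<close>,
      \<open>e\<close> into differences that vanish by symmetry.\<close>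
    have "g' (J' u) (c *\<^sub>R D' w - e *\<^sub>R D' v + br v w) + g' (J' v) (e *\<^sub>R D' u - a *\<^sub>R D' w + br w u)
        + g' (J' w) (a *\<^sub>R D' v - c *\<^sub>R D' u + br u v)
      = c * (g' (J' u) (D' w) - g' (J' w) (D' u)) + e * (g' (J' v) (D' u) - g' (J' u) (D' v))
        + a * (g' (J' w) (D' v) - g' (J' v) (D' w))"
      using \<omega>'_cocycle[of u v w] by (simp add: g_simps algebra_simps)
    also have "\<dots> = 0"
      using \<omega>'_D'_sym(2)[of u w] \<omega>'_D'_sym(2)[of v u] \<omega>'_D'_sym(2)[of w v] by simp
    finally have 1: "g' (J' u) (c *\<^sub>R D' w - e *\<^sub>R D' v + br v w)
        + g' (J' v) (e *\<^sub>R D' u - a *\<^sub>R D' w + br w u)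
        + g' (J' w) (a *\<^sub>R D' v - c *\<^sub>R D' u + br u v) = 0" .
    \<comment> \<open>\<open>?p\<close> is the \<kk>-component of a bracket. In this component of
      the Jacobi identity all \<open>D'\<close> terms cancel because \<open>D'\<close> is a
      derivation, leaving the Jacobi identity of \<kk>.\<close>
    let ?p = "\<lambda>a u c v. a *\<^sub>R D' v - c *\<^sub>R D' u + br u v"
    have "(a *\<^sub>R D' (?p c v e w) + br u (?p c v e w)) + (c *\<^sub>R D' (?p e w a u) + br v (?p e w a u))
        + (e *\<^sub>R D' (?p a u c v) + br w (?p a u c v)) = br u (br v w) + br v (br w u) + br w (br u v)"
      by (simp add: lin_simps br_simps D'_br br_anti[of _ "D' _"] scaleR_add_right scaleR_diff_right
          algebra_simps)
    then show "\<gg> x (\<gg> y z) + \<gg> y (\<gg> z x) + \<gg> z (\<gg> x y) = 0"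
      using 1 by (simp add: x y z bracket_eq jacobi zero_prod_def)
  qed
qed

section \<open>The Vaisman structure and its Lee form\<close>

lemma hermitian_g: "hermitian \<gg> J g"
  unfolding hermitian_def complex_structure_def
proof (intro conjI allI inner_product_g)
  show "linear J"
    by (rule linearI) (simp_all add: extend_complex_def lin_simps)
next
  fix x :: "real \<times> real \<times> 'a"
  show "J (J x) = - x" by (cases x) (simp add: J_eq J'_J')
next
  fix x y :: "real \<times> real \<times> 'a"
  obtain a b u where x: "x = (a, b, u)" by (cases x)
  obtain c d v where y: "y = (c, d, v)" by (cases y)
  show "g (J x) (J y) = g x y" by (simp add: x y J_eq g_eq g'_J'_J')
  have "br (J' u) (J' v) = br u v + J' (br (J' u) v + br u (J' v))"
    using integrable_J'[of u v] by (simp add: algebra_simps)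
  moreover have "D' (J' w) = J' (D' w)" for w using comm by simp
  ultimately show "\<gg> (J x) (J y) - \<gg> x y - J (\<gg> (J x) y + \<gg> x (J y)) = 0"
    by (simp add: x y J_eq bracket_eq lin_simps J'_J' g'_J'_J' \<omega>'_J' g_simps zero_prod_def algebra_simps)
qed

text \<open>With \<beta> the metric dual of B, the fundamental form \<omega> is \<theta> \<and>
  \<beta> + \<omega>', where \<omega>' is pulled back from \<kk>. The central term of the bracket
  gives d\<beta> = -\<omega>', so d(\<theta> \<and> \<beta>) = \<theta> \<and> \<omega>' = \<theta>
  \<and> \<omega>. The pullback of \<omega>' stays closed by
  \<open>\<omega>'_D'_sym\<close>.\<close>

lemma lee_form_\<theta>: "lee_form \<gg> J g \<theta>"
  unfolding lee_form_def
proof (intro conjI allI)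
  show "linear \<theta>" using bilinear_g by (simp add: bilinear_def)
next
  fix x y :: "real \<times> real \<times> 'a"
  show "d1 \<gg> \<theta> x y = 0"
    by (cases x; cases y) (simp only: d1_def bracket_eq \<theta>_eq neg_0_equal_iff_equal minus_zero)
next
  fix x y z :: "real \<times> real \<times> 'a"
  obtain a b u where x: "x = (a, b, u)" by (cases x)
  obtain c d v where y: "y = (c, d, v)" by (cases y)
  obtain e f w where z: "z = (e, f, w)" by (cases z)
  show "d2 \<gg> (fundamental_form J g) x y z = wedge12 \<theta> (fundamental_form J g) x y z"
    using closed_\<omega>'[of u v w] \<omega>'_D'_sym(1)[of v w] \<omega>'_D'_sym(1)[of w u] \<omega>'_D'_sym(1)[of u v]
    by (simp add: d2_def wedge12_def fundamental_form_def x y z \<theta>_eq bracket_eq J_eq g_eq lin_simps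
        g_simps algebra_simps)
qed

text \<open>In the Koszul formula tested against A, the first term vanishes since no bracket has an
  A-component; the other two cancel because A acts by the skew map \<open>D\<close>.\<close>

lemma parallel_form_\<theta>: "parallel_form \<gg> g \<theta>"
  unfolding parallel_form_def nabla_form_def
proof (intro allI)
  fix x y :: "real \<times> real \<times> 'a"
  obtain a b u where x: "x = (a, b, u)" by (cases x)
  obtain c d v where y: "y = (c, d, v)" by (cases y)
  have "\<theta> (nabla \<gg> g x y) = g (nabla \<gg> g x y) (1, 0, 0)" by (rule sym_extended_g)
  also have "\<dots> = 0"
    unfolding levi_civita[OF lie_algebra_\<gg> inner_product_g] x y bracket_eq g_eq
    using D'_skew[of v u] sym_g[of v "D' u"] by (simp add: lin_simps g_simps br_simps)
  finally show "- \<theta> (nabla \<gg> g x y) = 0" by simp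
qed

text \<open>Wedging 1-forms with a nondegenerate 2-form is injective from dimension 4 on, which
  \<open>x0\<close> guarantees. For \<kk> = 0 the extension is an abelian plane, where every linear
  form is a Lee form.\<close>

lemma lee_form_unique:
  assumes "(x0::'a) \<noteq> 0" and "lee_form \<gg> J g \<eta>"
  shows "\<eta> = \<theta>"
proof -
  define \<alpha> where "\<alpha> p = \<eta> p - \<theta> p" for p
  let ?\<omega> = "fundamental_form J g"
  have "linear \<alpha>"
    using assms(2) lee_form_\<theta> unfolding \<alpha>_def lee_form_def by (intro linear_compose_sub) auto
  have wedge: "wedge12 \<alpha> ?\<omega> p q r = 0" for p q r
  proof -
    have "wedge12 \<eta> ?\<omega> p q r = wedge12 \<theta> ?\<omega> p q r"
      using assms(2) lee_form_\<theta> unfolding lee_form_def by metis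
    then show ?thesis unfolding wedge12_def \<alpha>_def by argo
  qed
  \<comment> \<open>The plane of \<open>x0\<close> and \<open>J' x0\<close> is orthogonal to A and B
    and has nonzero area under the fundamental form, so only one wedge term survives. For
    \<open>K\<close> the plane of A and B plays this role.\<close>
  have AB: "\<alpha> (a, b, 0) = 0" for a b
    using wedge[of "(a, b, 0)" "(0, 0, x0)" "(0, 0, J' x0)"] pos_g[OF assms(1)]
    by (simp add: wedge12_def fundamental_form_def J_eq g_eq lin_simps g_simps g'_J'_J')
  have K: "\<alpha> (0, 0, v) = 0" for v
    using wedge[of "(0, 0, v)" "(1, 0, 0)" "(0, 1, 0)"]
    by (simp add: wedge12_def fundamental_form_def J_eq g_eq lin_simps g_simps)
  have "\<alpha> (a, b, v) = 0" for a b v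
    using linear_add[OF \<open>linear \<alpha>\<close>, of "(a, b, 0)" "(0, 0, v)"] AB K by simp
  then show ?thesis by (auto simp: \<alpha>_def)
qed

section \<open>Unimodularity and solvability\<close>

lemma unimodular_\<gg>: "unimodular \<gg>"
  unfolding unimodular_def
proof (intro allI)
  fix x :: "real \<times> real \<times> 'a"
  obtain a b u where x: "x = (a, b, u)" by (cases x)
  obtain E where E: "orthonormal_wrt g' E" "span E = UNIV" "\<And>x. (\<Sum>e\<in>E. g' (br x e) e) = 0"
    using traceless_basis by metis
  define \<iota> :: "'a \<Rightarrow> real \<times> real \<times> 'a" where "\<iota> v = (0, 0, v)" for v
  let ?F = "{(1, 0, 0), (0, 1, 0)} \<union> \<iota> ` E"
  have fin: "finite E" using E(1) by (simp add: orthonormal_wrt_def)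
  have inj: "inj_on \<iota> E" by (rule inj_onI) (simp add: \<iota>_def)
  have ortho: "orthonormal_wrt g ?F"
    using E(1) unfolding orthonormal_wrt_def
    by (auto simp: g_eq g_simps \<iota>_def)
  have lin: "linear (\<gg> x)" using bilinear_\<gg> unfolding bilinear_def by blast
  have "lin_trace (\<gg> x) = (\<Sum>e\<in>?F. g (\<gg> x e) e)"
    using lin_trace_orthonormal[OF lin bilinear_g ortho] span_extension[OF E(2)]
    by (simp add: \<iota>_def[abs_def])
  also have "\<dots> = g (\<gg> x (1, 0, 0)) (1, 0, 0) + (g (\<gg> x (0, 1, 0)) (0, 1, 0)
      + (\<Sum>e\<in>\<iota> ` E. g (\<gg> x e) e))"
    using fin by (simp add: \<iota>_def image_iff)
  \<comment> \<open>The first two diagonal entries vanish: no bracket has an A-component, and B is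
    central.\<close>
  also have "\<dots> = (\<Sum>e\<in>E. g (\<gg> x (\<iota> e)) (\<iota> e))"
    by (simp add: x bracket_eq g_eq g_simps br_simps lin_simps sum.reindex[OF inj])
  also have "\<dots> = (\<Sum>e\<in>E. g' (br u e) e)"
  proof (rule sum.cong[OF refl])
    fix e
    have "g' (D' e) e = 0" using D'_skew[of e e] sym_g[of e "D' e"] by simp
    then show "g (\<gg> x (\<iota> e)) (\<iota> e) = g' (br u e) e"
      by (simp add: \<iota>_def x bracket_eq g_eq g_simps)
  qed
  also have "\<dots> = 0" by (rule E(3))
  finally show "lin_trace (\<gg> x) = 0" .
qed

text \<open>The derived series descends through \<real>B \<oplus> \<kk>, \<real>B \<oplus> \<uu> and
  \<real>B to 0. Although \<uu> is abelian in \<kk>, \<open>\<omega>'\<close> may be nonzero on it,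
  whence the stage \<real>B.\<close>

lemma solvable_\<gg>: "solvable \<gg>"
proof -
  define V1 where "V1 = {p :: real \<times> real \<times> 'a. fst p = 0}"
  define V2 where "V2 = {p :: real \<times> real \<times> 'a. fst p = 0 \<and> snd (snd p) \<in> trans_ideal}"
  define V3 where "V3 = {p :: real \<times> real \<times> 'a. fst p = 0 \<and> snd (snd p) = 0}"
  have step: "derived_series \<gg> (Suc n) \<subseteq> V"
    if "derived_series \<gg> n \<subseteq> W" "subspace V" "\<And>x y. x \<in> W \<Longrightarrow> y \<in> W \<Longrightarrow> \<gg> x y \<in> V" for n V W
    unfolding derived_series.simps by (rule span_minimal) (use that in blast)+
  have "subspace V1" by (auto simp: subspace_def V1_def)
  moreover have "subspace V2"
    using subspace_trans_ideal by (auto simp: subspace_def V2_def)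
  moreover have "subspace V3" by (auto simp: subspace_def V3_def)
  moreover have "\<gg> x y \<in> V1" for x y
    by (cases x; cases y) (simp add: bracket_eq V1_def)
  moreover have "\<gg> x y \<in> V2" if "x \<in> V1" "y \<in> V1" for x y
    using that by (cases x; cases y) (simp add: bracket_eq V1_def V2_def br_in_trans_ideal)
  moreover have "\<gg> x y \<in> V3" if "x \<in> V2" "y \<in> V2" for x y
    using that by (cases x; cases y) (simp add: bracket_eq V2_def V3_def br_trans_ideal_abelian)
  moreover have "\<gg> x y \<in> {0}" if "x \<in> V3" "y \<in> V3" for x y
    using that by (cases x; cases y) (simp add: bracket_eq V3_def lin_simps g_simps br_simps zero_prod_def)
  ultimately have "derived_series \<gg> (Suc (Suc (Suc (Suc 0)))) \<subseteq> {0}"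
    by (intro step[of _ V3] step[of _ V2] step[of _ V1] step[of _ UNIV] subspace_single_0) simp_all
  moreover have "0 \<in> derived_series \<gg> (Suc n)" for n by (simp add: span_zero)
  ultimately show ?thesis unfolding solvable_def by blast
qed

end

theorem theorem3p10:
  fixes br :: "'a::real_vector \<Rightarrow> 'a \<Rightarrow> 'a"
    and J' D' :: "'a \<Rightarrow> 'a"
    and g' :: "'a \<Rightarrow> 'a \<Rightarrow> real"
  assumes "kahler_flat_lie_algebra br J' g'"
    and "lie_derivation br D'"
    and "skew_symmetric g' D'"
    and "\<forall>x. J' (D' x) = D' (J' x)"
  shows "let \<omega>' = fundamental_form J' g';
             D = extend_derivation D';
             \<gg> = double_extension br D \<omega>';
             J = extend_complex J';
             g = extend_metric (extend_metric g');
             A = (1, 0, 0);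
             \<theta> = (\<lambda>x. g A x)
         in lie_algebra (central_extension br \<omega>')
          \<and> lie_derivation (central_extension br \<omega>') D
          \<and> skew_symmetric (extend_metric g') D
          \<and> lie_algebra \<gg>
          \<and> vaisman \<gg> J g
          \<and> unimodular \<gg>
          \<and> solvable \<gg>
          \<and> lee_form \<gg> J g \<theta>
          \<and> parallel_form \<gg> g \<theta>
          \<and> ((\<exists>x::'a. x \<noteq> 0) \<longrightarrow> (\<forall>\<eta>. lee_form \<gg> J g \<eta> \<longrightarrow> \<eta> = \<theta>))"
proof -
  interpret kahler_flat_double_extension br J' D' g'
    using assms by unfold_locales
  show ?thesis
    unfolding Let_def vaisman_def
    using lie_algebra_central_extension lie_derivation_D skew_symmetric_D lie_algebra_\<gg>
      hermitian_g unimodular_\<gg> solvable_\<gg> lee_form_\<theta> parallel_form_\<theta> lee_form_unique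
    by blast
qed

end
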